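(* Consider a GBSM instance as in the context and a partial solution $(S',X')$ with $S'\subseteq S$, $X'\subseteq X$. Let $\epsilon\in(0,1)$ be such that $1/\epsilon$ is an integer, and suppose that for each $T\subseteq X$ with $|T|=\frac1\epsilon$ and for each $s\in S$ we have $\sum_{x\in T}c(s,x)\ge\frac1\epsilon c(s)$. Then the list $L=\{T\subseteq X\setminus X' : |T|\le \frac1\epsilon,\ c(S'\cup\{s_{\min}(T)\},T)\le k\}$ is a $(1-\epsilon)$-list with respect to $(S',X')$.
   Context: GBSM: Let $X$ be a finite set of $n$ elements and $S$ a finite set of $m$ bins. Each bin $s\in S$ has a cost $c(s)\in\mathbb{R}_{\ge0}$, and for each $s\in S$, $x\in X$ there is a cost $c(s,x)\ge 0$ of associating $x$ to $s$. Let $k\in\mathbb{R}_{\ge0}$ be a budget and $f:2^X\to\mathbb{R}_{\ge0}$ a monotone nondecreasing submodular function. For $S'\subseteq S$, $X'\subseteq X$ let $c(S',X')=\sum_{s\in S'}c(s)+\sum_{x\in X'}\min_{s\in S'}c(s,x)$. For a partial solution $(S',X')$: $c_{S'}(s)=c(s)$ if $s\notin S'$ and $c_{S'}(s)=0$ if $s\in S'$; for $T\subseteq X\setminus X'$, $c_{\min}(T)=\min_{s\in S}\{c_{S'}(s)+\sum_{x\in T}c(s,x)\}$, $s_{\min}(T)$ is a bin attaining this minimum, and $g(T)=f(X'\cup T)-f(X')$. Let $\mathcal F=\{T\subseteq X\setminus X' : c(S'\cup\{s_{\min}(T)\},T)\le k\}$. A family $L\subseteq\mathcal F$ is an $\alpha$-list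 with respect to $(S',X')$ if $\max\{g(T)/c_{\min}(T): T\in L, c_{\min}(T)>0\}\ge \alpha\max\{g(T)/c_{\min}(T): T\in\mathcal F, c_{\min}(T)>0\}$. Standing assumption of the paper: partial solutions considered satisfy $c_{\min}(T)>0$ for every $T\in\mathcal F$. *)

theory Defs
  imports Complex_Main
begin

locale gbsm =
  fixes X :: "'x set" and S :: "'s set"
    and bin_cost :: "'s \<Rightarrow> real" and assoc_cost :: "'s \<Rightarrow> 'x \<Rightarrow> real"
    and k :: real and f :: "'x set \<Rightarrow> real"
  assumes finite_X: "finite X"
    and finite_S: "finite S"
    and bin_cost_nonneg: "\<And>s. s \<in> S \<Longrightarrow> 0 \<le> bin_cost s"
    and assoc_cost_nonneg: "\<And>s x. s \<in> S \<Longrightarrow> x \<in> X \<Longrightarrow> 0 \<le> assoc_cost s x"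
    and budget_nonneg: "0 \<le> k"
    and f_nonneg: "\<And>A. A \<subseteq> X \<Longrightarrow> 0 \<le> f A"
    and f_mono: "\<And>A B. A \<subseteq> B \<Longrightarrow> B \<subseteq> X \<Longrightarrow> f A \<le> f B"
    and f_submodular:
      "\<And>A B. A \<subseteq> X \<Longrightarrow> B \<subseteq> X \<Longrightarrow> f (A \<union> B) + f (A \<inter> B) \<le> f A + f B"

definition total_cost ::
  "('s \<Rightarrow> real) \<Rightarrow> ('s \<Rightarrow> 'x \<Rightarrow> real) \<Rightarrow> 's set \<Rightarrow> 'x set \<Rightarrow> real" where
  "total_cost bin_cost assoc_cost S' X' =
     (\<Sum>s\<in>S'. bin_cost s) + (\<Sum>x\<in>X'. MIN s\<in>S'. assoc_cost s x)"

definition residual_bin_cost :: "('s \<Rightarrow> real) \<Rightarrow> 's set \<Rightarrow> 's \<Rightarrow> real" where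
  "residual_bin_cost bin_cost S' s = (if s \<in> S' then 0 else bin_cost s)"

definition single_bin_cost ::
  "('s \<Rightarrow> real) \<Rightarrow> ('s \<Rightarrow> 'x \<Rightarrow> real) \<Rightarrow> 's set \<Rightarrow> 'x set \<Rightarrow> 's \<Rightarrow> real" where
  "single_bin_cost bin_cost assoc_cost S' T s =
     residual_bin_cost bin_cost S' s + (\<Sum>x\<in>T. assoc_cost s x)"

definition c_min ::
  "'s set \<Rightarrow> ('s \<Rightarrow> real) \<Rightarrow> ('s \<Rightarrow> 'x \<Rightarrow> real) \<Rightarrow> 's set \<Rightarrow> 'x set \<Rightarrow> real" where
  "c_min S bin_cost assoc_cost S' T =
     (MIN s\<in>S. single_bin_cost bin_cost assoc_cost S' T s)"

text \<open>A minimizing bin need not be unique, so the choice of a minimizer is kept as a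
  function \<open>s_min\<close> subject to this predicate, which leaves the tie-breaking arbitrary.\<close>

definition is_s_min ::
  "'x set \<Rightarrow> 's set \<Rightarrow> ('s \<Rightarrow> real) \<Rightarrow> ('s \<Rightarrow> 'x \<Rightarrow> real) \<Rightarrow> 's set \<Rightarrow> 'x set
     \<Rightarrow> ('x set \<Rightarrow> 's) \<Rightarrow> bool" where
  "is_s_min X S bin_cost assoc_cost S' X' s_min \<longleftrightarrow>
     (\<forall>T \<subseteq> X - X'. s_min T \<in> S \<and>
        single_bin_cost bin_cost assoc_cost S' T (s_min T) = c_min S bin_cost assoc_cost S' T)"

definition gain :: "('x set \<Rightarrow> real) \<Rightarrow> 'x set \<Rightarrow> 'x set \<Rightarrow> real" where
  "gain f X' T = f (X' \<union> T) - f X'"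

definition feasible_sets ::
  "'x set \<Rightarrow> ('s \<Rightarrow> real) \<Rightarrow> ('s \<Rightarrow> 'x \<Rightarrow> real) \<Rightarrow> real \<Rightarrow> 's set \<Rightarrow> 'x set
     \<Rightarrow> ('x set \<Rightarrow> 's) \<Rightarrow> 'x set set" where
  "feasible_sets X bin_cost assoc_cost k S' X' s_min =
     {T. T \<subseteq> X - X' \<and> total_cost bin_cost assoc_cost (S' \<union> {s_min T}) T \<le> k}"

definition ratios ::
  "'s set \<Rightarrow> ('s \<Rightarrow> real) \<Rightarrow> ('s \<Rightarrow> 'x \<Rightarrow> real) \<Rightarrow> ('x set \<Rightarrow> real) \<Rightarrow> 's set \<Rightarrow> 'x set
     \<Rightarrow> 'x set set \<Rightarrow> real set" where
  "ratios S bin_cost assoc_cost f S' X' \<A> =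
     {gain f X' T / c_min S bin_cost assoc_cost S' T | T.
        T \<in> \<A> \<and> 0 < c_min S bin_cost assoc_cost S' T}"

text \<open>\<open>Max {}\<close> is unspecified. If no feasible set has positive cost, neither maximum exists and
  the inequality is read as vacuous; otherwise the list must itself contain a set of positive
  cost, so that both maxima exist.\<close>

definition alpha_list ::
  "'x set \<Rightarrow> 's set \<Rightarrow> ('s \<Rightarrow> real) \<Rightarrow> ('s \<Rightarrow> 'x \<Rightarrow> real) \<Rightarrow> real \<Rightarrow> ('x set \<Rightarrow> real)
     \<Rightarrow> 's set \<Rightarrow> 'x set \<Rightarrow> ('x set \<Rightarrow> 's) \<Rightarrow> real \<Rightarrow> 'x set set \<Rightarrow> bool" where
  "alpha_list X S bin_cost assoc_cost k f S' X' s_min \<alpha> L \<longleftrightarrow>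
     (let \<F> = feasible_sets X bin_cost assoc_cost k S' X' s_min;
          R = ratios S bin_cost assoc_cost f S' X'
      in L \<subseteq> \<F> \<and>
         (R \<F> \<noteq> {} \<longrightarrow> R L \<noteq> {} \<and> Max (R L) \<ge> \<alpha> * Max (R \<F>)))"

end

theory Submission
  imports Defs
begin

text \<open>Let \<open>T\<close> be feasible with cheapest bin \<open>s\<close>. Split \<open>T\<close> into the set \<open>B\<close> of elements for which
  \<open>s\<close> is a cheapest bin among \<open>S' \<union> {s}\<close>, and the rest \<open>A\<close>, served more cheaply by \<open>S'\<close>.
  Passing to a subset may change the minimizing bin and hence destroy feasibility, but the singletons
  of \<open>A\<close> and all subsets of \<open>B\<close> stay feasible. Cutting \<open>B\<close> into chunks of size \<open>1/\<epsilon>\<close>, the bin cost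
  paid again for each further chunk is at most an \<open>\<epsilon>\<close> fraction of the association cost of a
  full chunk. So if every set in the list has gain at most \<open>M\<close> times its cost, subadditivity of the
  gain yields a gain of \<open>T\<close> of at most \<open>(1 + \<epsilon>) M\<close> times its cost, and \<open>(1 - \<epsilon>) (1 + \<epsilon>) \<le> 1\<close>.\<close>

section \<open>Chunking under a subadditive set function\<close>

lemma chunk_bound:
  fixes h :: "'a set \<Rightarrow> real" and w :: "'a \<Rightarrow> real"
  assumes "finite B" and "0 < p" and "0 \<le> M" and "0 \<le> e"
    and w: "\<And>x. x \<in> B \<Longrightarrow> 0 \<le> w x"
    and subadd: "\<And>C D. C \<subseteq> B \<Longrightarrow> D \<subseteq> B \<Longrightarrow> h (C \<union> D) \<le> h C + h D"
    and small: "\<And>C. C \<subseteq> B \<Longrightarrow> card C \<le> p \<Longrightarrow> h C \<le> M * (c + sum w C)"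
    and chunk: "\<And>C. C \<subseteq> B \<Longrightarrow> card C = p \<Longrightarrow> c \<le> e * sum w C"
  shows "h B \<le> M * (c + (1 + e) * sum w B)"
proof -
  have "h D \<le> M * (c + (1 + e) * sum w D)" if "D \<subseteq> B" for D
    using that
  proof (induction "card D" arbitrary: D rule: less_induct)
    case less
    have finD: "finite D" using less.prems \<open>finite B\<close> finite_subset by blast
    have wD: "0 \<le> sum w D" using less.prems w by (auto intro!: sum_nonneg)
    show ?case
    proof (cases "card D \<le> p")
      case True
      have "h D \<le> M * (c + sum w D)" using small less.prems True by blast
      also have "\<dots> \<le> M * (c + (1 + e) * sum w D)"
        using \<open>0 \<le> M\<close> \<open>0 \<le> e\<close> wD by (intro mult_left_mono) (auto simp: algebra_simps)
      finally show ?thesis .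
    next
      case False
      \<comment> \<open>A chunk of exactly \<open>p\<close> elements is split off, since only full
        chunks are assumed to pay for \<open>c\<close>. The last piece, possibly smaller, falls
        under the first case and keeps the single \<open>c\<close> of the bound.\<close>
      then obtain C where C: "C \<subseteq> D" "card C = p"
        by (meson nat_le_linear obtain_subset_with_card_n)
      have finC: "finite C" using C finD finite_subset by blast
      have CB: "C \<subseteq> B" "D - C \<subseteq> B" using C less.prems by auto
      have "card (D - C) < card D"
        using C False \<open>0 < p\<close> finC by (simp add: card_Diff_subset)
      then have IH: "h (D - C) \<le> M * (c + (1 + e) * sum w (D - C))"
        using less.hyps CB by blast
      have split: "sum w D = sum w C + sum w (D - C)"
        using C finD by (metis add.commute sum.subset_diff)
      have "h D = h (C \<union> (D - C))" using C by (simp add: Un_absorb1)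
      also have "\<dots> \<le> h C + h (D - C)" using subadd CB by blast
      also have "\<dots> \<le> M * (c + sum w C) + M * (c + (1 + e) * sum w (D - C))"
        using IH small[OF CB(1)] C by simp
      also have "\<dots> = M * (c + sum w C + c + (1 + e) * sum w (D - C))"
        by (simp add: algebra_simps)
      \<comment> \<open>One of the two copies of \<open>c\<close> is at most
        \<open>e * sum w C\<close> and turns \<open>sum w C\<close> into
        \<open>(1 + e) * sum w C\<close>; the other stays as the \<open>c\<close> of the
        bound.\<close>
      also have "\<dots> \<le> M * (c + (1 + e) * sum w D)"
        using \<open>0 \<le> M\<close> chunk[OF CB(1) C(2)] split
        by (intro mult_left_mono) (auto simp: algebra_simps)
      finally show ?thesis .
    qed
  qed
  then show ?thesis by blast
qed

section \<open>Budget cost versus single-bin cost\<close>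

lemma sum_residual_bin_cost:
  assumes "finite S'"
  shows "sum bin_cost (S' \<union> {s}) = sum bin_cost S' + residual_bin_cost bin_cost S' s"
  using assms by (auto simp: residual_bin_cost_def insert_absorb)

text \<open>Sending all of \<open>T\<close> to \<open>s\<close> is one way of serving it, and adding
  \<open>s\<close> to \<open>S'\<close> costs exactly its residual cost. The inequality can be
  strict, since the budget lets bins of \<open>S'\<close> serve some elements more cheaply.\<close>

lemma total_cost_le_single_bin_cost:
  assumes "finite S'"
  shows "total_cost bin_cost assoc_cost (S' \<union> {s}) T
           \<le> sum bin_cost S' + single_bin_cost bin_cost assoc_cost S' T s"
proof -
  have "(\<Sum>x\<in>T. MIN t\<in>S' \<union> {s}. assoc_cost t x) \<le> (\<Sum>x\<in>T. assoc_cost s x)"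
    using assms by (intro sum_mono Min_le) auto
  then show ?thesis
    using sum_residual_bin_cost[OF assms, of bin_cost s]
    by (simp add: total_cost_def single_bin_cost_def)
qed

lemma c_min_le:
  assumes "finite S" and "s \<in> S"
  shows "c_min S bin_cost assoc_cost S' T \<le> single_bin_cost bin_cost assoc_cost S' T s"
  unfolding c_min_def using assms by (intro Min_le) auto

section \<open>Subadditivity of gains\<close>

context gbsm
begin

lemma gain_nonneg:
  assumes "Y \<subseteq> X" "T \<subseteq> X"
  shows "0 \<le> gain f Y T"
  using f_mono[of Y "Y \<union> T"] assms by (simp add: gain_def)

text \<open>Submodularity is applied to \<open>Y \<union> A\<close> and \<open>Y \<union> B\<close>:
  their intersection contains \<open>Y\<close>, so by monotonicity \<open>f Y\<close> may replace
  the value there.\<close>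

lemma gain_subadditive:
  assumes "Y \<subseteq> X" "A \<subseteq> X" "B \<subseteq> X"
  shows "gain f Y (A \<union> B) \<le> gain f Y A + gain f Y B"
proof -
  have "f ((Y \<union> A) \<union> (Y \<union> B)) + f ((Y \<union> A) \<inter> (Y \<union> B)) \<le> f (Y \<union> A) + f (Y \<union> B)"
    using assms by (intro f_submodular) auto
  moreover have "f Y \<le> f ((Y \<union> A) \<inter> (Y \<union> B))"
    using assms by (intro f_mono) auto
  moreover have "(Y \<union> A) \<union> (Y \<union> B) = Y \<union> (A \<union> B)" by auto
  ultimately show ?thesis by (simp add: gain_def)
qed

lemma gain_le_sum:
  assumes "Y \<subseteq> X" "A \<subseteq> X"
  shows "gain f Y A \<le> (\<Sum>x\<in>A. gain f Y {x})"
proof -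
  have "finite A" using assms finite_X finite_subset by blast
  then show ?thesis using assms(2)
  proof (induction A rule: finite_induct)
    case empty
    then show ?case by (simp add: gain_def)
  next
    case (insert x A)
    then have "gain f Y ({x} \<union> A) \<le> gain f Y {x} + gain f Y A"
      by (intro gain_subadditive assms) auto
    with insert show ?case by simp
  qed
qed

lemma c_min_nonneg:
  assumes "S \<noteq> {}" "T \<subseteq> X"
  shows "0 \<le> c_min S bin_cost assoc_cost S' T"
  unfolding c_min_def single_bin_cost_def residual_bin_cost_def
  using assms finite_S bin_cost_nonneg assoc_cost_nonneg
  by (auto simp: subset_iff intro!: add_nonneg_nonneg sum_nonneg)

section \<open>Feasibility of subsets\<close>

text \<open>Once \<open>sum bin_cost S'\<close> is added, the right side of \<open>cost\<close> is
  the budget cost of \<open>T\<close> and the left side bounds that of \<open>U\<close>. So only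
  \<open>c_min\<close> of \<open>U\<close> matters, whichever bin \<open>s_min U\<close> is.\<close>

lemma feasible_subset_cost:
  assumes S': "S' \<subseteq> S" and s_min: "is_s_min X S bin_cost assoc_cost S' X' s_min"
    and T: "T \<in> feasible_sets X bin_cost assoc_cost k S' X' s_min" and U: "U \<subseteq> T"
    and cost: "c_min S bin_cost assoc_cost S' U
      \<le> residual_bin_cost bin_cost S' (s_min T) + (\<Sum>x\<in>T. MIN t\<in>S' \<union> {s_min T}. assoc_cost t x)"
  shows "U \<in> feasible_sets X bin_cost assoc_cost k S' X' s_min"
proof -
  have fin: "finite S'" using S' finite_S finite_subset by blast
  have TX: "T \<subseteq> X - X'" and Tk: "total_cost bin_cost assoc_cost (S' \<union> {s_min T}) T \<le> k"
    using T by (auto simp: feasible_sets_def)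
  have "single_bin_cost bin_cost assoc_cost S' U (s_min U) = c_min S bin_cost assoc_cost S' U"
    using s_min TX U by (auto simp: is_s_min_def)
  then have "total_cost bin_cost assoc_cost (S' \<union> {s_min U}) U
      \<le> sum bin_cost S' + c_min S bin_cost assoc_cost S' U"
    using total_cost_le_single_bin_cost[OF fin] by metis
  also have "\<dots> \<le> total_cost bin_cost assoc_cost (S' \<union> {s_min T}) T"
    using cost sum_residual_bin_cost[OF fin, of bin_cost "s_min T"] by (simp add: total_cost_def)
  finally show ?thesis
    using TX U Tk by (auto simp: feasible_sets_def)
qed

text \<open>\<open>\<delta> x\<close> is the price that the budget charges for \<open>x\<close> in
  \<open>T\<close>. If \<open>s\<close> attains it on all of \<open>U\<close>, then \<open>s\<close>
  serves \<open>U\<close> at prices already paid. If \<open>s\<close> does not attain it at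
  \<open>x\<close>, a bin of \<open>S'\<close> does, and its residual cost is zero.\<close>

lemma feasible_subsets:
  fixes S' X' T s_min
  defines "s \<equiv> s_min T"
  defines "\<delta> \<equiv> \<lambda>x. MIN t\<in>S' \<union> {s}. assoc_cost t x"
  assumes S': "S' \<subseteq> S" and s_min: "is_s_min X S bin_cost assoc_cost S' X' s_min"
    and T: "T \<in> feasible_sets X bin_cost assoc_cost k S' X' s_min"
  shows feasible_own_subset:
      "\<And>U. U \<subseteq> {x \<in> T. assoc_cost s x = \<delta> x}
        \<Longrightarrow> U \<in> feasible_sets X bin_cost assoc_cost k S' X' s_min"
    and feasible_other_singleton:
      "\<And>x. x \<in> T \<Longrightarrow> assoc_cost s x \<noteq> \<delta> x
        \<Longrightarrow> {x} \<in> feasible_sets X bin_cost assoc_cost k S' X' s_min"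
    and other_singleton_cost:
      "\<And>x. x \<in> T \<Longrightarrow> assoc_cost s x \<noteq> \<delta> x
        \<Longrightarrow> c_min S bin_cost assoc_cost S' {x} \<le> assoc_cost s x"
proof -
  have fin: "finite S'" using S' finite_S finite_subset by blast
  have TX: "T \<subseteq> X - X'" using T by (auto simp: feasible_sets_def)
  have finT: "finite T" using TX finite_X finite_subset by blast
  have sS: "s \<in> S" using s_min TX by (auto simp: is_s_min_def s_def)
  have res: "0 \<le> residual_bin_cost bin_cost S' s"
    using bin_cost_nonneg sS by (auto simp: residual_bin_cost_def)
  have \<delta>_in: "\<delta> x \<in> (\<lambda>t. assoc_cost t x) ` (S' \<union> {s})" for x
    unfolding \<delta>_def using fin by (intro Min_in) auto
  have \<delta>_le: "\<delta> x \<le> assoc_cost s x" for x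
    unfolding \<delta>_def using fin by (intro Min_le) auto
  have \<delta>_nonneg: "0 \<le> \<delta> x" if "x \<in> T" for x
    using \<delta>_in[of x] assoc_cost_nonneg sS S' TX that by (auto simp: subset_iff)
  \<comment> \<open>Prices are nonnegative, so it suffices to stay within the price of
    \<open>U\<close> instead of that of \<open>T\<close>.\<close>
  have cost: "U \<in> feasible_sets X bin_cost assoc_cost k S' X' s_min"
    if "U \<subseteq> T" "c_min S bin_cost assoc_cost S' U \<le> residual_bin_cost bin_cost S' s + sum \<delta> U" for U
  proof -
    have "sum \<delta> U \<le> sum \<delta> T" using that finT \<delta>_nonneg by (intro sum_mono2) auto
    then show ?thesis
      using feasible_subset_cost[OF S' s_min T that(1)] that(2) unfolding \<delta>_def s_def by simp
  qed
  show "U \<in> feasible_sets X bin_cost assoc_cost k S' X' s_min"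
    if "U \<subseteq> {x \<in> T. assoc_cost s x = \<delta> x}" for U
  proof -
    have "(\<Sum>x\<in>U. assoc_cost s x) = sum \<delta> U" using that by (intro sum.cong) auto
    then show ?thesis
      using that c_min_le[OF finite_S sS, of bin_cost assoc_cost S' U]
      by (intro cost) (auto simp: single_bin_cost_def)
  qed
  have single: "c_min S bin_cost assoc_cost S' {x} \<le> \<delta> x"
    if x: "x \<in> T" "assoc_cost s x \<noteq> \<delta> x" for x
  proof -
    obtain t where t: "t \<in> S'" "\<delta> x = assoc_cost t x" using \<delta>_in[of x] x by auto
    then have "single_bin_cost bin_cost assoc_cost S' {x} t = \<delta> x"
      by (simp add: single_bin_cost_def residual_bin_cost_def)
    with c_min_le[OF finite_S] t S' show ?thesis by (metis subsetD)
  qed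
  show "{x} \<in> feasible_sets X bin_cost assoc_cost k S' X' s_min"
    if "x \<in> T" "assoc_cost s x \<noteq> \<delta> x" for x
    using single[OF that] that res by (intro cost) auto
  show "c_min S bin_cost assoc_cost S' {x} \<le> assoc_cost s x"
    if "x \<in> T" "assoc_cost s x \<noteq> \<delta> x" for x
    using single[OF that] \<delta>_le[of x] by simp
qed

lemma feasible_singleton:
  assumes "S' \<subseteq> S" and "is_s_min X S bin_cost assoc_cost S' X' s_min"
    and "T \<in> feasible_sets X bin_cost assoc_cost k S' X' s_min" and "x \<in> T"
  shows "{x} \<in> feasible_sets X bin_cost assoc_cost k S' X' s_min"
  using feasible_own_subset[OF assms(1-3), of "{x}"] feasible_other_singleton[OF assms(1-3), of x]
    assms(4) by auto

section \<open>Gain bound for one feasible set\<close>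

text \<open>\<open>M\<close> stands for the best ratio in the list and \<open>p\<close> for
  \<open>1 / e\<close>. Products replace quotients so that the empty set, whose cost may be zero,
  needs no exception.\<close>

lemma gain_bound:
  assumes S': "S' \<subseteq> S" and X': "X' \<subseteq> X"
    and s_min: "is_s_min X S bin_cost assoc_cost S' X' s_min"
    and T: "T \<in> feasible_sets X bin_cost assoc_cost k S' X' s_min"
    and "0 < p" and "0 \<le> M" and e: "0 \<le> e" "e \<le> 1"
    and chunk: "\<And>U s. U \<subseteq> X \<Longrightarrow> card U = p \<Longrightarrow> s \<in> S
      \<Longrightarrow> bin_cost s \<le> e * (\<Sum>x\<in>U. assoc_cost s x)"
    and small: "\<And>U. U \<in> feasible_sets X bin_cost assoc_cost k S' X' s_min \<Longrightarrow> card U \<le> p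
      \<Longrightarrow> gain f X' U \<le> M * c_min S bin_cost assoc_cost S' U"
  shows "(1 - e) * gain f X' T \<le> M * c_min S bin_cost assoc_cost S' T"
proof -
  define s where "s = s_min T"
  define r where "r = residual_bin_cost bin_cost S' s"
  define B where "B = {x \<in> T. assoc_cost s x = (MIN t\<in>S' \<union> {s}. assoc_cost t x)}"
  let ?w = "assoc_cost s"
  have TX: "T \<subseteq> X - X'" using T by (auto simp: feasible_sets_def)
  have finT: "finite T" using TX finite_X finite_subset by blast
  have sS: "s \<in> S" and cT: "c_min S bin_cost assoc_cost S' T = r + sum ?w T"
    using s_min TX unfolding is_s_min_def s_def r_def single_bin_cost_def by auto
  \<comment> \<open>\<open>r\<close> is zero if \<open>s\<close> is already open; in either case the
    chunk hypothesis for \<open>bin_cost s\<close> also covers \<open>r\<close>.\<close>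
  have r: "0 \<le> r" "r \<le> bin_cost s"
    using bin_cost_nonneg[OF sS] by (auto simp: r_def residual_bin_cost_def)
  have BT: "B \<subseteq> T" by (auto simp: B_def)
  then have BX: "B \<subseteq> X" and AX: "T - B \<subseteq> X" using TX by auto
  have finB: "finite B" using BT finT finite_subset by blast
  have w: "0 \<le> ?w x" if "x \<in> T" for x using that assoc_cost_nonneg sS TX by auto
  have gB: "gain f X' B \<le> M * (r + (1 + e) * sum ?w B)"
  proof (rule chunk_bound[OF finB \<open>0 < p\<close> \<open>0 \<le> M\<close> \<open>0 \<le> e\<close>])
    show "gain f X' (C \<union> D) \<le> gain f X' C + gain f X' D" if "C \<subseteq> B" "D \<subseteq> B" for C D
      using gain_subadditive X' BX that by (meson order_trans)
    show "r \<le> e * sum ?w C" if "C \<subseteq> B" "card C = p" for C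
      using chunk[of C s] that BX sS r by (meson order_trans)
    show "gain f X' C \<le> M * (r + sum ?w C)" if "C \<subseteq> B" "card C \<le> p" for C
    proof -
      have "C \<in> feasible_sets X bin_cost assoc_cost k S' X' s_min"
        using feasible_own_subset[OF S' s_min T] that(1) unfolding B_def s_def by blast
      then have "gain f X' C \<le> M * c_min S bin_cost assoc_cost S' C"
        using small that(2) by blast
      also have "\<dots> \<le> M * (r + sum ?w C)"
        using c_min_le[OF finite_S sS, of bin_cost assoc_cost S' C] \<open>0 \<le> M\<close>
        by (intro mult_left_mono) (auto simp: single_bin_cost_def r_def)
      finally show ?thesis .
    qed
  qed (use w BT in auto)
  \<comment> \<open>These elements are taken one by one: they may prefer different bins of
    \<open>S'\<close>, so larger sets of them may be infeasible, while each alone incurs no opening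
    cost.\<close>
  have single: "gain f X' {x} \<le> M * ?w x" if "x \<in> T - B" for x
  proof -
    have x: "x \<in> T" "assoc_cost (s_min T) x \<noteq> (MIN t\<in>S' \<union> {s_min T}. assoc_cost t x)"
      using that by (auto simp: B_def s_def)
    have "gain f X' {x} \<le> M * c_min S bin_cost assoc_cost S' {x}"
      using small feasible_other_singleton[OF S' s_min T x] \<open>0 < p\<close> by simp
    also have "\<dots> \<le> M * ?w x"
      using other_singleton_cost[OF S' s_min T x] \<open>0 \<le> M\<close>
      by (intro mult_left_mono) (auto simp: s_def)
    finally show ?thesis .
  qed
  have "gain f X' (T - B) \<le> (\<Sum>x\<in>T - B. gain f X' {x})" using gain_le_sum X' AX by blast
  also have "\<dots> \<le> M * sum ?w (T - B)" unfolding sum_distrib_left by (intro sum_mono single)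
  \<comment> \<open>The factor is inserted so that the sums over \<open>T - B\<close> and
    \<open>B\<close> combine.\<close>
  also have "\<dots> \<le> M * ((1 + e) * sum ?w (T - B))"
  proof -
    have "0 \<le> sum ?w (T - B)" using w by (auto intro!: sum_nonneg)
    then show ?thesis
      using \<open>0 \<le> M\<close> e by (intro mult_left_mono) (auto simp: algebra_simps)
  qed
  finally have gA: "gain f X' (T - B) \<le> M * ((1 + e) * sum ?w (T - B))" .
  have split: "sum ?w T = sum ?w (T - B) + sum ?w B" using sum.subset_diff[OF BT finT] .
  have "gain f X' T = gain f X' (B \<union> (T - B))" using BT by (simp add: Un_absorb1)
  also have "\<dots> \<le> gain f X' B + gain f X' (T - B)" using gain_subadditive X' BX AX by blast
  also have "\<dots> \<le> M * (r + (1 + e) * sum ?w T)"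
    using gA gB unfolding split by (simp add: algebra_simps)
  finally have "(1 - e) * gain f X' T \<le> (1 - e) * (M * (r + (1 + e) * sum ?w T))"
    using e by (intro mult_left_mono) auto
  \<comment> \<open>The factor \<open>1 - e\<close> turns the weight \<open>1 + e\<close> into
    \<open>1 - e * e\<close>, leaving only nonnegative terms to subtract.\<close>
  also have "\<dots> = M * (r + sum ?w T - (e * r + e * e * sum ?w T))" by (simp add: algebra_simps)
  also have "\<dots> \<le> M * (r + sum ?w T)"
  proof -
    have "0 \<le> e * r" "0 \<le> e * e * sum ?w T"
      using e r w by (auto intro!: mult_nonneg_nonneg sum_nonneg)
    then show ?thesis using \<open>0 \<le> M\<close> by (intro mult_left_mono) auto
  qed
  finally show ?thesis using cT by simp
qed

end

section \<open>Comparison of the two maxima\<close>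

theorem theorem2:
  fixes X :: "'x set" and S :: "'s set"
    and bin_cost :: "'s \<Rightarrow> real" and assoc_cost :: "'s \<Rightarrow> 'x \<Rightarrow> real"
    and k :: real and f :: "'x set \<Rightarrow> real"
    and S' :: "'s set" and X' :: "'x set"
    and s_min :: "'x set \<Rightarrow> 's" and \<epsilon> :: real
  assumes instance_gbsm: "gbsm X S bin_cost assoc_cost k f"
    and partial_bins: "S' \<subseteq> S"
    and partial_elements: "X' \<subseteq> X"
    and s_min: "is_s_min X S bin_cost assoc_cost S' X' s_min"
    and c_min_pos: "\<And>T. T \<in> feasible_sets X bin_cost assoc_cost k S' X' s_min \<Longrightarrow> T \<noteq> {}
                       \<Longrightarrow> 0 < c_min S bin_cost assoc_cost S' T"
    and eps: "0 < \<epsilon>" "\<epsilon> < 1" "1 / \<epsilon> \<in> \<int>"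
    and cost_bound: "\<And>T s. T \<subseteq> X \<Longrightarrow> real (card T) = 1 / \<epsilon> \<Longrightarrow> s \<in> S
                       \<Longrightarrow> (\<Sum>x\<in>T. assoc_cost s x) \<ge> (1 / \<epsilon>) * bin_cost s"
  shows "alpha_list X S bin_cost assoc_cost k f S' X' s_min (1 - \<epsilon>)
           {T. T \<subseteq> X - X' \<and> real (card T) \<le> 1 / \<epsilon> \<and>
               total_cost bin_cost assoc_cost (S' \<union> {s_min T}) T \<le> k}"
proof -
  interpret gbsm X S bin_cost assoc_cost k f by (rule instance_gbsm)
  let ?F = "feasible_sets X bin_cost assoc_cost k S' X' s_min"
  let ?R = "ratios S bin_cost assoc_cost f S' X'"
  let ?c = "c_min S bin_cost assoc_cost S'"
  define L where "L = {T. T \<subseteq> X - X' \<and> real (card T) \<le> 1 / \<epsilon> \<and>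
               total_cost bin_cost assoc_cost (S' \<union> {s_min T}) T \<le> k}"
  obtain i :: int where i: "1 / \<epsilon> = of_int i" using eps(3) by (auto elim: Ints_cases)
  define p where "p = nat i"
  have "0 < i" using i eps by (metis of_int_0_less_iff zero_less_divide_1_iff)
  then have p: "real p = 1 / \<epsilon>" "0 < p" using i by (auto simp: p_def)
  have L: "L = {T \<in> ?F. card T \<le> p}"
    unfolding L_def feasible_sets_def p(1)[symmetric] by auto
  have FX: "T \<subseteq> X" if "T \<in> ?F" for T using that by (auto simp: feasible_sets_def)
  \<comment> \<open>\<open>s_min {}\<close> is an element of \<open>S\<close>.\<close>
  have "S \<noteq> {}" using s_min by (auto simp: is_s_min_def)
  have finF: "finite ?F" using finite_subset[of ?F "Pow X"] finite_X FX by auto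
  have finR: "finite (?R A)" if "A \<subseteq> ?F" for A
  proof -
    have "?R A \<subseteq> (\<lambda>T. gain f X' T / ?c T) ` A" by (auto simp: ratios_def)
    then show ?thesis using finF that by (meson finite_imageI finite_subset)
  qed
  have LF: "L \<subseteq> ?F" using L by auto
  have "?R L \<noteq> {} \<and> (1 - \<epsilon>) * Max (?R ?F) \<le> Max (?R L)" if ne: "?R ?F \<noteq> {}"
  proof -
    define M where "M = Max (?R L)"
    obtain T0 where T0: "T0 \<in> ?F" "0 < ?c T0" using ne by (auto simp: ratios_def)
    \<comment> \<open>The empty set has size zero and is itself in the list; a nonempty feasible set
      contributes a feasible singleton, of size \<open>1 \<le> p\<close>.\<close>
    have neL: "?R L \<noteq> {}"
    proof (cases "T0 = {}")
      case True
      then show ?thesis using T0 L by (auto simp: ratios_def)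
    next
      case False
      then obtain x where "x \<in> T0" by auto
      then have "{x} \<in> ?F" using feasible_singleton[OF partial_bins s_min] T0 by blast
      moreover from this have "0 < ?c {x}" using c_min_pos by blast
      moreover have "card {x} \<le> p" using p by simp
      ultimately show ?thesis using L by (auto simp: ratios_def)
    qed
    \<comment> \<open>Being attained, \<open>M\<close> is a nonnegative gain divided by a positive
      cost.\<close>
    have "M \<in> ?R L" unfolding M_def using finR[OF LF] neL by (rule Max_in)
    then have M: "0 \<le> M"
      using gain_nonneg[OF partial_elements] FX LF by (auto simp: ratios_def)
    have small: "gain f X' U \<le> M * ?c U" if U: "U \<in> ?F" "card U \<le> p" for U
    proof (cases "0 < ?c U")
      case True
      then have "gain f X' U / ?c U \<le> M"
        unfolding M_def using U L finR[OF LF] by (intro Max_ge) (auto simp: ratios_def)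
      then show ?thesis using True by (simp add: divide_le_eq)
    next
      \<comment> \<open>By \<open>c_min_pos\<close> only the empty set is left; its gain is zero,
        and \<open>M\<close> times its cost is nonnegative.\<close>
      case False
      then have "U = {}" using c_min_pos U by blast
      then show ?thesis using c_min_nonneg[OF \<open>S \<noteq> {}\<close>] M by (simp add: gain_def)
    qed
    have chunk: "bin_cost s \<le> \<epsilon> * (\<Sum>x\<in>U. assoc_cost s x)"
      if "U \<subseteq> X" "card U = p" "s \<in> S" for U s
      using cost_bound[of U s] that p eps by (simp add: field_simps)
    have "Max (?R ?F) \<in> ?R ?F" using finR ne by (intro Max_in) auto
    then obtain T where T: "T \<in> ?F" "0 < ?c T" "Max (?R ?F) = gain f X' T / ?c T"
      by (auto simp: ratios_def)
    have "(1 - \<epsilon>) * gain f X' T \<le> M * ?c T"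
      using eps
      by (intro gain_bound[OF partial_bins partial_elements s_min T(1) p(2) M _ _ chunk small]) auto
    then have "(1 - \<epsilon>) * Max (?R ?F) \<le> M"
      using T by (simp add: divide_le_eq)
    with neL show ?thesis by (simp add: M_def)
  qed
  then show ?thesis
    using LF unfolding alpha_list_def Let_def L_def by blast
qed

end
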